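(* Let a compact Lie group $G$ act continuously on a nonempty finite set $\bar{\mathbf{x}}$, and let $F$ be a $G$-equivariant topological complex vector bundle over $\bar{\mathbf{x}}$. A pointwise clutching map $\psi$ with respect to $F$ is equivariant if and only if the vector space $F/\psi$ can be equipped with a complex $G$-representation structure such that the quotient map $p_\psi:F\to F/\psi$ is $G$-equivariant. If such a $G$-representation structure exists, it is unique.
   Context: Representations are finite-dimensional (and continuous). $F_{\bar{x}}$ denotes the fiber of $F$ over $\bar{x}\in\bar{\mathbf{x}}$. For vector spaces $V,W$, $\mathrm{iso}(V,W)$ is the set of all linear isomorphisms $V\to W$ (no group action considered). A pointwise clutching map with respect to $F$ is an element $\psi$ of $\prod_{(\bar{x},\bar{x}')\in\bar{\mathbf{x}}\times\bar{\mathbf{x}}}\mathrm{iso}(F_{\bar{x}},F_{\bar{x}'})$, with components $\psi(\bar{x},\bar{x}')$, such that for all $\bar{x},\bar{x}',\bar{x}''\in\bar{\mathbf{x}}$: $\psi(\bar{x},\bar{x})=\mathrm{id}_{F_{\bar{x}}}$; $\psi(\bar{x},\bar{x}')=\psi(\bar{x}',\bar{x})^{-1}$; $\psi(\bar{x},\bar{x}'')=\psi(\bar{x}',\bar{x}'')\psi(\bar{x},\bar{x}')$. The group $G$ acts on pointwise clutching maps by $(g\cdot\psi)(\bar{x},\bar{x}')\bar{u}=g\,\psi(g^{-1}\bar{x},g^{-1}\bar{x}')\,g^{-1}\bar{u}$ for $\bar{u}\in F_{\bar{x}}$; $\psi$ is called equivariant if $g\cdot\psi=\psi$ for all $g\in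 G$. For a pointwise clutching map $\psi$, $F/\psi$ is the quotient of $F$ by the equivalence relation $\bar{u}\sim\bar{u}' \iff \psi(\bar{x},\bar{x}')\bar{u}=\bar{u}'$ (for $\bar{u}\in F_{\bar{x}}$, $\bar{u}'\in F_{\bar{x}'}$), and $p_\psi:F\to F/\psi$ is the quotient map; $F/\psi$ has the unique vector space structure for which $p_\psi$ restricts to a linear isomorphism on each fiber. *)

theory Defs
  imports "HOL-Analysis.Analysis" "HOL-Algebra.Algebra" "HOL-Algebra.Algebraic_Closure_Type"
begin

section \<open>Smooth manifolds and Lie groups\<close>

text \<open>
  The model space is \<^const>\<open>Euclidean_space\<close> \<open>n\<close>, so that dimension 0 (finite groups) is covered;
  a type of class \<^class>\<open>euclidean_space\<close> always has positive dimension.  Functions on a subset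
  \<open>W\<close> of the model space are total in HOL, but for \<open>W\<close> open only the values on \<open>W\<close> matter below.
\<close>

definition partial_deriv :: "nat \<Rightarrow> ((nat \<Rightarrow> real) \<Rightarrow> real) \<Rightarrow> (nat \<Rightarrow> real) \<Rightarrow> real" where
  "partial_deriv i f x = deriv (\<lambda>t. f (x(i := t))) (x i)"

primrec Ck_on :: "nat \<Rightarrow> nat \<Rightarrow> (nat \<Rightarrow> real) set \<Rightarrow> ((nat \<Rightarrow> real) \<Rightarrow> real) \<Rightarrow> bool" where
  "Ck_on 0 n W f \<longleftrightarrow> continuous_map (subtopology (Euclidean_space n) W) euclideanreal f"
| "Ck_on (Suc k) n W f \<longleftrightarrow>
     (\<forall>i<n. (\<forall>x\<in>W. (\<lambda>t. f (x(i := t))) field_differentiable (at (x i))) \<and>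
            Ck_on k n W (partial_deriv i f))"

definition smooth_on :: "nat \<Rightarrow> nat \<Rightarrow> (nat \<Rightarrow> real) set \<Rightarrow> ((nat \<Rightarrow> real) \<Rightarrow> (nat \<Rightarrow> real)) \<Rightarrow> bool" where
  "smooth_on n m W f \<longleftrightarrow> (\<forall>j<m. \<forall>k. Ck_on k n W (\<lambda>x. f x j))"

type_synonym 'a chart = "'a set \<times> ('a \<Rightarrow> nat \<Rightarrow> real)"

definition is_chart :: "'a topology \<Rightarrow> nat \<Rightarrow> 'a chart \<Rightarrow> bool" where
  "is_chart T n = (\<lambda>(U, c). openin T U \<and> openin (Euclidean_space n) (c ` U) \<and>
     homeomorphic_map (subtopology T U) (subtopology (Euclidean_space n) (c ` U)) c)"

definition smooth_atlas :: "'a topology \<Rightarrow> nat \<Rightarrow> 'a chart set \<Rightarrow> bool" where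
  "smooth_atlas T n A \<longleftrightarrow>
     (\<forall>C\<in>A. is_chart T n C) \<and> (\<Union>(U, c)\<in>A. U) = topspace T \<and>
     (\<forall>(U, c)\<in>A. \<forall>(V, d)\<in>A. smooth_on n n (c ` (U \<inter> V)) (\<lambda>z. d (inv_into U c z)))"

definition smooth_manifold :: "'a topology \<Rightarrow> nat \<Rightarrow> 'a chart set \<Rightarrow> bool" where
  "smooth_manifold T n A \<longleftrightarrow> Hausdorff_space T \<and> second_countable T \<and> smooth_atlas T n A"

definition smooth_map ::
  "'a topology \<Rightarrow> nat \<Rightarrow> 'a chart set \<Rightarrow> 'b topology \<Rightarrow> nat \<Rightarrow> 'b chart set \<Rightarrow> ('a \<Rightarrow> 'b) \<Rightarrow> bool" where
  "smooth_map S n A T m B f \<longleftrightarrow> continuous_map S T f \<and>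
     (\<forall>(U, c)\<in>A. \<forall>(V, d)\<in>B.
        smooth_on n m (c ` {a \<in> U. f a \<in> V}) (\<lambda>z. d (f (inv_into U c z))))"

text \<open>The product atlas on a product of manifolds, the first one having dimension \<open>n\<close>.\<close>

definition prod_atlas :: "nat \<Rightarrow> 'a chart set \<Rightarrow> 'b chart set \<Rightarrow> ('a \<times> 'b) chart set" where
  "prod_atlas n A B =
     {(U \<times> V, \<lambda>(a, b) i. if i < n then c a i else d b (i - n)) | U c V d. (U, c) \<in> A \<and> (V, d) \<in> B}"

definition lie_group :: "('g, 'm) monoid_scheme \<Rightarrow> 'g topology \<Rightarrow> nat \<Rightarrow> 'g chart set \<Rightarrow> bool" where
  "lie_group G T n A \<longleftrightarrow>
     group G \<and> topspace T = carrier G \<and> smooth_manifold T n A \<and>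
     smooth_map (prod_topology T T) (n + n) (prod_atlas n A A) T n A (\<lambda>(a, b). a \<otimes>\<^bsub>G\<^esub> b) \<and>
     smooth_map T n A T n A (\<lambda>a. inv\<^bsub>G\<^esub> a)"

definition compact_lie_group :: "('g, 'm) monoid_scheme \<Rightarrow> 'g topology \<Rightarrow> nat \<Rightarrow> 'g chart set \<Rightarrow> bool" where
  "compact_lie_group G T n A \<longleftrightarrow> lie_group G T n A \<and> compact_space T"

definition continuous_action ::
  "('g, 'm) monoid_scheme \<Rightarrow> 'g topology \<Rightarrow> 'a topology \<Rightarrow> ('g \<Rightarrow> 'a \<Rightarrow> 'a) \<Rightarrow> bool" where
  "continuous_action G T B \<phi> \<longleftrightarrow>
     group_action G (topspace B) \<phi> \<and> continuous_map (prod_topology T B) B (\<lambda>(g, x). \<phi> g x)"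


section \<open>Complex vector spaces and representations\<close>

abbreviation complex_field :: "complex ring" where
  "complex_field \<equiv> ring_of_type_algebra"

abbreviation complex_vector_space :: "(complex, 'a) module \<Rightarrow> bool" where
  "complex_vector_space V \<equiv> Module.module complex_field V"

text \<open>Linear maps are extensional functions, so that equality of functions is equality of maps.\<close>

definition linear_maps :: "(complex, 'a) module \<Rightarrow> (complex, 'b) module \<Rightarrow> ('a \<Rightarrow> 'b) set" where
  "linear_maps V W = {f \<in> carrier V \<rightarrow>\<^sub>E carrier W.
     (\<forall>u\<in>carrier V. \<forall>v\<in>carrier V. f (u \<oplus>\<^bsub>V\<^esub> v) = f u \<oplus>\<^bsub>W\<^esub> f v) \<and>
     (\<forall>c. \<forall>u\<in>carrier V. f (c \<odot>\<^bsub>V\<^esub> u) = c \<odot>\<^bsub>W\<^esub> f u)}"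

definition linear_iso :: "(complex, 'a) module \<Rightarrow> (complex, 'b) module \<Rightarrow> ('a \<Rightarrow> 'b) set" where
  "linear_iso V W = {f \<in> linear_maps V W. bij_betw f (carrier V) (carrier W)}"

text \<open>The space of complex \<open>n\<close>-tuples.  The \<open>mult\<close> and \<open>one\<close> fields that module records inherit
  from ring records are irrelevant for modules.\<close>

definition cvec :: "nat \<Rightarrow> (complex, nat \<Rightarrow> complex) module" where
  "cvec n = \<lparr> carrier = {z. \<forall>i\<ge>n. z i = 0}, mult = undefined, one = undefined,
     ring.zero = (\<lambda>i. 0), ring.add = (\<lambda>z w i. z i + w i), module.smult = (\<lambda>c z i. c * z i) \<rparr>"

definition cvec_topology :: "nat \<Rightarrow> (nat \<Rightarrow> complex) topology" where
  "cvec_topology n = subtopology (product_topology (\<lambda>_. euclidean) UNIV) (carrier (cvec n))"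

definition fin_dim :: "(complex, 'a) module \<Rightarrow> bool" where
  "fin_dim V \<longleftrightarrow> (\<exists>n. linear_iso (cvec n) V \<noteq> {})"

text \<open>The canonical topology of a finite-dimensional complex vector space, for which all linear
  coordinate systems are homeomorphisms.\<close>

definition canonical_topology :: "(complex, 'a) module \<Rightarrow> 'a topology" where
  "canonical_topology V = topology (\<lambda>U. U \<subseteq> carrier V \<and>
     (\<forall>n. \<forall>f\<in>linear_iso (cvec n) V. openin (cvec_topology n) {z \<in> carrier (cvec n). f z \<in> U}))"

lemma openin_canonical_topology:
  "openin (canonical_topology V) U \<longleftrightarrow> U \<subseteq> carrier V \<and>
     (\<forall>n. \<forall>f\<in>linear_iso (cvec n) V. openin (cvec_topology n) {z \<in> carrier (cvec n). f z \<in> U})"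
proof -
  have "istopology (\<lambda>U. U \<subseteq> carrier V \<and>
     (\<forall>n. \<forall>f\<in>linear_iso (cvec n) V. openin (cvec_topology n) {z \<in> carrier (cvec n). f z \<in> U}))"
    unfolding istopology_def
  proof (intro conjI allI impI ballI)
    fix S S' n f
    assume S: "S \<subseteq> carrier V \<and> (\<forall>n. \<forall>f\<in>linear_iso (cvec n) V.
        openin (cvec_topology n) {z \<in> carrier (cvec n). f z \<in> S})"
      and S': "S' \<subseteq> carrier V \<and> (\<forall>n. \<forall>f\<in>linear_iso (cvec n) V.
        openin (cvec_topology n) {z \<in> carrier (cvec n). f z \<in> S'})"
    show "S \<inter> S' \<subseteq> carrier V" using S by blast
    assume f: "f \<in> linear_iso (cvec n) V"
    have "{z \<in> carrier (cvec n). f z \<in> S \<inter> S'} =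
        {z \<in> carrier (cvec n). f z \<in> S} \<inter> {z \<in> carrier (cvec n). f z \<in> S'}" by blast
    then show "openin (cvec_topology n) {z \<in> carrier (cvec n). f z \<in> S \<inter> S'}"
      using S S' f by auto
  next
    fix K n f
    assume K: "\<forall>S\<in>K. S \<subseteq> carrier V \<and> (\<forall>n. \<forall>f\<in>linear_iso (cvec n) V.
        openin (cvec_topology n) {z \<in> carrier (cvec n). f z \<in> S})"
    show "\<Union>K \<subseteq> carrier V" using K by blast
    assume f: "f \<in> linear_iso (cvec n) V"
    have "{z \<in> carrier (cvec n). f z \<in> \<Union>K} = (\<Union>S\<in>K. {z \<in> carrier (cvec n). f z \<in> S})" by blast
    then show "openin (cvec_topology n) {z \<in> carrier (cvec n). f z \<in> \<Union>K}"
      using K f by auto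
  qed
  then show ?thesis
    by (simp add: canonical_topology_def topology_inverse')
qed

lemma topspace_canonical_topology: "topspace (canonical_topology V) = carrier V"
proof -
  have "openin (canonical_topology V) (carrier V)"
    unfolding openin_canonical_topology
  proof (intro conjI allI ballI)
    fix n f assume "f \<in> linear_iso (cvec n) V"
    then have "{z \<in> carrier (cvec n). f z \<in> carrier V} = topspace (cvec_topology n)"
      by (auto simp: linear_iso_def linear_maps_def cvec_topology_def)
    then show "openin (cvec_topology n) {z \<in> carrier (cvec n). f z \<in> carrier V}" by simp
  qed simp
  then show ?thesis
    by (meson openin_canonical_topology openin_subset openin_topspace subset_antisym)
qed

definition complex_representation ::
  "('g, 'm) monoid_scheme \<Rightarrow> 'g topology \<Rightarrow> (complex, 'a) module \<Rightarrow> ('g \<Rightarrow> 'a \<Rightarrow> 'a) \<Rightarrow> bool" where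
  "complex_representation G T V \<tau> \<longleftrightarrow>
     complex_vector_space V \<and> fin_dim V \<and>
     continuous_action G T (canonical_topology V) \<tau> \<and>
     (\<forall>g\<in>carrier G. \<tau> g \<in> linear_maps V V)"


section \<open>Equivariant complex vector bundles\<close>

record ('x, 'f) complex_bundle =
  total_space :: "'f topology"
  bundle_proj :: "'f \<Rightarrow> 'x"
  fiber :: "'x \<Rightarrow> (complex, 'f) module"

text \<open>The rank \<open>n\<close> of a local trivialization may vary from point to point.\<close>

definition vector_bundle :: "'x topology \<Rightarrow> ('x, 'f) complex_bundle \<Rightarrow> bool" where
  "vector_bundle B F \<longleftrightarrow>
     continuous_map (total_space F) B (bundle_proj F) \<and>
     (\<forall>x\<in>topspace B. complex_vector_space (fiber F x) \<and>
        carrier (fiber F x) = {u \<in> topspace (total_space F). bundle_proj F u = x}) \<and>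
     (\<forall>x\<in>topspace B. \<exists>U n h. openin B U \<and> x \<in> U \<and>
        homeomorphic_map (subtopology (total_space F) {u \<in> topspace (total_space F). bundle_proj F u \<in> U})
          (prod_topology (subtopology B U) (cvec_topology n)) h \<and>
        (\<forall>y\<in>U. (\<forall>u\<in>carrier (fiber F y). fst (h u) = y) \<and>
           restrict (snd \<circ> h) (carrier (fiber F y)) \<in> linear_iso (fiber F y) (cvec n)))"

definition equivariant_vector_bundle ::
  "('g, 'm) monoid_scheme \<Rightarrow> 'g topology \<Rightarrow> 'x topology \<Rightarrow> ('g \<Rightarrow> 'x \<Rightarrow> 'x) \<Rightarrow>
   ('x, 'f) complex_bundle \<Rightarrow> ('g \<Rightarrow> 'f \<Rightarrow> 'f) \<Rightarrow> bool" where
  "equivariant_vector_bundle G T B \<phi> F \<rho> \<longleftrightarrow>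
     vector_bundle B F \<and> continuous_action G T (total_space F) \<rho> \<and>
     (\<forall>g\<in>carrier G. \<forall>u\<in>topspace (total_space F). bundle_proj F (\<rho> g u) = \<phi> g (bundle_proj F u)) \<and>
     (\<forall>g\<in>carrier G. \<forall>x\<in>topspace B.
        restrict (\<rho> g) (carrier (fiber F x)) \<in> linear_maps (fiber F x) (fiber F (\<phi> g x)))"


section \<open>Pointwise clutching maps\<close>

definition pointwise_clutching_map ::
  "'x set \<Rightarrow> ('x, 'f) complex_bundle \<Rightarrow> ('x \<times> 'x \<Rightarrow> 'f \<Rightarrow> 'f) \<Rightarrow> bool" where
  "pointwise_clutching_map S F \<psi> \<longleftrightarrow>
     \<psi> \<in> (\<Pi>\<^sub>E (x, x')\<in>S \<times> S. linear_iso (fiber F x) (fiber F x')) \<and>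
     (\<forall>x\<in>S. \<psi> (x, x) = (\<lambda>u\<in>carrier (fiber F x). u)) \<and>
     (\<forall>x\<in>S. \<forall>x'\<in>S. \<psi> (x, x') =
        restrict (inv_into (carrier (fiber F x')) (\<psi> (x', x))) (carrier (fiber F x))) \<and>
     (\<forall>x\<in>S. \<forall>x'\<in>S. \<forall>x''\<in>S.
        \<psi> (x, x'') = compose (carrier (fiber F x)) (\<psi> (x', x'')) (\<psi> (x, x')))"

definition clutching_action ::
  "('g, 'm) monoid_scheme \<Rightarrow> 'x set \<Rightarrow> ('g \<Rightarrow> 'x \<Rightarrow> 'x) \<Rightarrow> ('x, 'f) complex_bundle \<Rightarrow> ('g \<Rightarrow> 'f \<Rightarrow> 'f) \<Rightarrow>
   'g \<Rightarrow> ('x \<times> 'x \<Rightarrow> 'f \<Rightarrow> 'f) \<Rightarrow> ('x \<times> 'x \<Rightarrow> 'f \<Rightarrow> 'f)" where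
  "clutching_action G S \<phi> F \<rho> g \<psi> =
     (\<lambda>(x, x')\<in>S \<times> S. \<lambda>u\<in>carrier (fiber F x).
        \<rho> g (\<psi> (\<phi> (inv\<^bsub>G\<^esub> g) x, \<phi> (inv\<^bsub>G\<^esub> g) x') (\<rho> (inv\<^bsub>G\<^esub> g) u)))"

definition equivariant_clutching_map ::
  "('g, 'm) monoid_scheme \<Rightarrow> 'x set \<Rightarrow> ('g \<Rightarrow> 'x \<Rightarrow> 'x) \<Rightarrow> ('x, 'f) complex_bundle \<Rightarrow> ('g \<Rightarrow> 'f \<Rightarrow> 'f) \<Rightarrow>
   ('x \<times> 'x \<Rightarrow> 'f \<Rightarrow> 'f) \<Rightarrow> bool" where
  "equivariant_clutching_map G S \<phi> F \<rho> \<psi> \<longleftrightarrow>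
     (\<forall>g\<in>carrier G. clutching_action G S \<phi> F \<rho> g \<psi> = \<psi>)"

definition clutching_rel :: "'x set \<Rightarrow> ('x, 'f) complex_bundle \<Rightarrow> ('x \<times> 'x \<Rightarrow> 'f \<Rightarrow> 'f) \<Rightarrow> ('f \<times> 'f) set" where
  "clutching_rel S F \<psi> = {(u, u'). \<exists>x\<in>S. \<exists>x'\<in>S.
     u \<in> carrier (fiber F x) \<and> u' \<in> carrier (fiber F x') \<and> \<psi> (x, x') u = u'}"

definition clutching_proj :: "'x set \<Rightarrow> ('x, 'f) complex_bundle \<Rightarrow> ('x \<times> 'x \<Rightarrow> 'f \<Rightarrow> 'f) \<Rightarrow> 'f \<Rightarrow> 'f set" where
  "clutching_proj S F \<psi> u = clutching_rel S F \<psi> `` {u}"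

text \<open>
  The quotient with its vector space structure.  An operation on classes is performed on
  representatives lying in a common fiber; the unions are over all such choices, whose results
  coincide.  The lemmas at the end show that this is the unique structure for which the projection
  is a linear isomorphism on each fiber.
\<close>

definition clutching_quotient ::
  "'x set \<Rightarrow> ('x, 'f) complex_bundle \<Rightarrow> ('x \<times> 'x \<Rightarrow> 'f \<Rightarrow> 'f) \<Rightarrow> (complex, 'f set) module" where
  "clutching_quotient S F \<psi> = \<lparr> carrier = topspace (total_space F) // clutching_rel S F \<psi>,
     mult = undefined, one = undefined,
     ring.zero = (\<Union>x\<in>S. clutching_proj S F \<psi> \<zero>\<^bsub>fiber F x\<^esub>),
     ring.add = (\<lambda>P Q. \<Union>x\<in>S. \<Union>u\<in>P \<inter> carrier (fiber F x). \<Union>v\<in>Q \<inter> carrier (fiber F x).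
              clutching_proj S F \<psi> (u \<oplus>\<^bsub>fiber F x\<^esub> v)),
     module.smult = (\<lambda>c P. \<Union>x\<in>S. \<Union>u\<in>P \<inter> carrier (fiber F x). clutching_proj S F \<psi> (c \<odot>\<^bsub>fiber F x\<^esub> u)) \<rparr>"

definition quotient_representation ::
  "('g, 'm) monoid_scheme \<Rightarrow> 'g topology \<Rightarrow> 'x set \<Rightarrow> ('x, 'f) complex_bundle \<Rightarrow> ('g \<Rightarrow> 'f \<Rightarrow> 'f) \<Rightarrow>
   ('x \<times> 'x \<Rightarrow> 'f \<Rightarrow> 'f) \<Rightarrow> ('g \<Rightarrow> 'f set \<Rightarrow> 'f set) \<Rightarrow> bool" where
  "quotient_representation G T S F \<rho> \<psi> \<tau> \<longleftrightarrow>
     complex_representation G T (clutching_quotient S F \<psi>) \<tau> \<and>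
     (\<forall>g\<in>carrier G. \<forall>u\<in>topspace (total_space F).
        clutching_proj S F \<psi> (\<rho> g u) = \<tau> g (clutching_proj S F \<psi> u))"

context
  fixes S :: "'x set" and F :: "('x, 'f) complex_bundle" and \<psi> :: "'x \<times> 'x \<Rightarrow> 'f \<Rightarrow> 'f"
  assumes F: "vector_bundle (discrete_topology S) F"
    and \<psi>: "pointwise_clutching_map S F \<psi>"
begin

private lemma fiber_space: "x \<in> S \<Longrightarrow> complex_vector_space (fiber F x)"
  using F by (simp add: vector_bundle_def)

private lemma fiber_carrier:
  "x \<in> S \<Longrightarrow> u \<in> carrier (fiber F x) \<longleftrightarrow> u \<in> topspace (total_space F) \<and> bundle_proj F u = x"
  using F by (simp add: vector_bundle_def)

private lemma total_cases:
  assumes "u \<in> topspace (total_space F)"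
  obtains x where "x \<in> S" "u \<in> carrier (fiber F x)"
proof -
  have "bundle_proj F \<in> topspace (total_space F) \<rightarrow> S"
    using F by (force simp: vector_bundle_def dest: continuous_map_funspace)
  with assms that fiber_carrier show thesis by blast
qed

private lemma psi_iso: "\<lbrakk>x \<in> S; x' \<in> S\<rbrakk> \<Longrightarrow> \<psi> (x, x') \<in> linear_iso (fiber F x) (fiber F x')"
proof -
  assume "x \<in> S" "x' \<in> S"
  moreover have "\<psi> \<in> (\<Pi>\<^sub>E (x, x')\<in>S \<times> S. linear_iso (fiber F x) (fiber F x'))"
    using \<psi> by (simp add: pointwise_clutching_map_def)
  ultimately show ?thesis by (force dest: PiE_mem[of _ _ _ "(x, x')"])
qed

private lemma psi_closed:
  "\<lbrakk>x \<in> S; x' \<in> S; u \<in> carrier (fiber F x)\<rbrakk> \<Longrightarrow> \<psi> (x, x') u \<in> carrier (fiber F x')"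
  using psi_iso[of x x'] by (auto simp: linear_iso_def linear_maps_def)

private lemma psi_id: "\<lbrakk>x \<in> S; u \<in> carrier (fiber F x)\<rbrakk> \<Longrightarrow> \<psi> (x, x) u = u"
  using \<psi> by (simp add: pointwise_clutching_map_def)

private lemma psi_comp:
  assumes "x \<in> S" "x' \<in> S" "x'' \<in> S" "u \<in> carrier (fiber F x)"
  shows "\<psi> (x', x'') (\<psi> (x, x') u) = \<psi> (x, x'') u"
proof -
  have "\<psi> (x, x'') = compose (carrier (fiber F x)) (\<psi> (x', x'')) (\<psi> (x, x'))"
    using \<psi> assms(1-3) unfolding pointwise_clutching_map_def by blast
  then show ?thesis using assms by (simp add: compose_def)
qed

private lemma class_eq:
  assumes "x \<in> S" "u \<in> carrier (fiber F x)"
  shows "clutching_proj S F \<psi> u = (\<lambda>x'. \<psi> (x, x') u) ` S"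
proof -
  have "y = x" if "y \<in> S" "u \<in> carrier (fiber F y)" for y
    using assms that by (simp add: fiber_carrier)
  then show ?thesis
    using assms psi_closed[of x _ u] unfolding clutching_proj_def clutching_rel_def by blast
qed

private lemma class_inter:
  assumes "x \<in> S" "y \<in> S" "u \<in> carrier (fiber F x)"
  shows "clutching_proj S F \<psi> u \<inter> carrier (fiber F y) = {\<psi> (x, y) u}"
  using assms psi_closed[OF assms(1) _ assms(3)] by (auto simp: class_eq fiber_carrier)

private lemma class_psi:
  assumes "x \<in> S" "y \<in> S" "u \<in> carrier (fiber F x)"
  shows "clutching_proj S F \<psi> (\<psi> (x, y) u) = clutching_proj S F \<psi> u"
  unfolding class_eq[OF assms(2) psi_closed[OF assms]] class_eq[OF assms(1,3)]
  by (intro image_cong refl psi_comp assms)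

private lemma class_add:
  assumes x: "x \<in> S" and u: "u \<in> carrier (fiber F x)" and v: "v \<in> carrier (fiber F x)"
  shows "clutching_proj S F \<psi> u \<oplus>\<^bsub>clutching_quotient S F \<psi>\<^esub> clutching_proj S F \<psi> v
       = clutching_proj S F \<psi> (u \<oplus>\<^bsub>fiber F x\<^esub> v)"
proof -
  interpret M: Module.module complex_field "fiber F x" using fiber_space[OF x] .
  have "clutching_proj S F \<psi> (\<psi> (x, y) u \<oplus>\<^bsub>fiber F y\<^esub> \<psi> (x, y) v)
      = clutching_proj S F \<psi> (u \<oplus>\<^bsub>fiber F x\<^esub> v)" if y: "y \<in> S" for y
  proof -
    have "\<psi> (x, y) (u \<oplus>\<^bsub>fiber F x\<^esub> v) = \<psi> (x, y) u \<oplus>\<^bsub>fiber F y\<^esub> \<psi> (x, y) v"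
      using psi_iso[OF x y] u v by (simp add: linear_iso_def linear_maps_def)
    then show ?thesis using class_psi[OF x y, of "u \<oplus>\<^bsub>fiber F x\<^esub> v"] u v by simp
  qed
  then show ?thesis using x u v by (auto simp: clutching_quotient_def class_inter)
qed

private lemma class_smult:
  assumes x: "x \<in> S" and u: "u \<in> carrier (fiber F x)"
  shows "c \<odot>\<^bsub>clutching_quotient S F \<psi>\<^esub> clutching_proj S F \<psi> u
       = clutching_proj S F \<psi> (c \<odot>\<^bsub>fiber F x\<^esub> u)"
proof -
  interpret M: Module.module complex_field "fiber F x" using fiber_space[OF x] .
  have cu: "c \<odot>\<^bsub>fiber F x\<^esub> u \<in> carrier (fiber F x)"
    using u by (intro M.smult_closed) (simp_all add: ring_of_type_algebra_def)
  have "clutching_proj S F \<psi> (c \<odot>\<^bsub>fiber F y\<^esub> \<psi> (x, y) u)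
      = clutching_proj S F \<psi> (c \<odot>\<^bsub>fiber F x\<^esub> u)" if y: "y \<in> S" for y
  proof -
    have "\<psi> (x, y) (c \<odot>\<^bsub>fiber F x\<^esub> u) = c \<odot>\<^bsub>fiber F y\<^esub> \<psi> (x, y) u"
      using psi_iso[OF x y] u by (simp add: linear_iso_def linear_maps_def)
    then show ?thesis using class_psi[OF x y cu] by simp
  qed
  then show ?thesis using x u by (auto simp: clutching_quotient_def class_inter)
qed

private lemma class_zero:
  assumes x: "x \<in> S"
  shows "\<zero>\<^bsub>clutching_quotient S F \<psi>\<^esub> = clutching_proj S F \<psi> \<zero>\<^bsub>fiber F x\<^esub>"
proof -
  interpret M: Module.module complex_field "fiber F x" using fiber_space[OF x] .
  have eq: "clutching_proj S F \<psi> \<zero>\<^bsub>fiber F y\<^esub> = clutching_proj S F \<psi> \<zero>\<^bsub>fiber F x\<^esub>" if y: "y \<in> S" for y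
  proof -
    interpret N: Module.module complex_field "fiber F y" using fiber_space[OF y] .
    let ?z = "\<psi> (x, y) \<zero>\<^bsub>fiber F x\<^esub>"
    have z: "?z \<in> carrier (fiber F y)" using psi_closed[OF x y] by simp
    have "\<psi> (x, y) (\<zero>\<^bsub>fiber F x\<^esub> \<oplus>\<^bsub>fiber F x\<^esub> \<zero>\<^bsub>fiber F x\<^esub>) = ?z \<oplus>\<^bsub>fiber F y\<^esub> ?z"
      using psi_iso[OF x y] M.zero_closed unfolding linear_iso_def linear_maps_def by blast
    then have "?z \<oplus>\<^bsub>fiber F y\<^esub> ?z = ?z" by simp
    then have "?z = \<zero>\<^bsub>fiber F y\<^esub>" using N.add.l_cancel_one[OF z z] by simp
    then show ?thesis using class_psi[OF x y M.zero_closed] by simp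
  qed
  have "(\<Union>y\<in>S. clutching_proj S F \<psi> \<zero>\<^bsub>fiber F y\<^esub>) = (\<Union>y\<in>S. clutching_proj S F \<psi> \<zero>\<^bsub>fiber F x\<^esub>)"
    by (intro SUP_cong refl eq)
  also have "\<dots> = clutching_proj S F \<psi> \<zero>\<^bsub>fiber F x\<^esub>" using x by blast
  finally show ?thesis by (simp add: clutching_quotient_def)
qed

private lemma class_bij:
  assumes x: "x \<in> S"
  shows "bij_betw (clutching_proj S F \<psi>) (carrier (fiber F x)) (carrier (clutching_quotient S F \<psi>))"
proof (rule bij_betwI')
  fix u v assume u: "u \<in> carrier (fiber F x)" and v: "v \<in> carrier (fiber F x)"
  show "clutching_proj S F \<psi> u = clutching_proj S F \<psi> v \<longleftrightarrow> u = v"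
    by (metis class_inter psi_id singleton_inject u v x)
next
  fix u assume u: "u \<in> carrier (fiber F x)"
  then show "clutching_proj S F \<psi> u \<in> carrier (clutching_quotient S F \<psi>)"
    using fiber_carrier[OF x, of u]
    by (auto simp: clutching_quotient_def clutching_proj_def intro: quotientI)
next
  fix P assume "P \<in> carrier (clutching_quotient S F \<psi>)"
  then obtain w where w: "w \<in> topspace (total_space F)" "P = clutching_proj S F \<psi> w"
    by (auto simp: clutching_quotient_def clutching_proj_def elim: quotientE)
  obtain y where y: "y \<in> S" "w \<in> carrier (fiber F y)" using total_cases[OF w(1)] .
  then show "\<exists>u\<in>carrier (fiber F x). P = clutching_proj S F \<psi> u"
    using class_psi[OF y(1) x y(2)] psi_closed[OF y(1) x y(2)] w by metis
qed

lemma clutching_proj_linear_iso: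
  assumes x: "x \<in> S"
  shows "restrict (clutching_proj S F \<psi>) (carrier (fiber F x)) \<in> linear_iso (fiber F x) (clutching_quotient S F \<psi>)"
proof -
  interpret M: Module.module complex_field "fiber F x" using fiber_space[OF x] .
  have c: "c \<odot>\<^bsub>fiber F x\<^esub> u \<in> carrier (fiber F x)" if "u \<in> carrier (fiber F x)" for c u
    using that by (intro M.smult_closed) (simp_all add: ring_of_type_algebra_def)
  show ?thesis
    using class_bij[OF x] c bij_betw_apply[OF class_bij[OF x]]
    by (auto simp: linear_iso_def linear_maps_def class_add[OF x] class_smult[OF x] cong: bij_betw_cong)
qed

lemma complex_vector_space_clutching_quotient:
  assumes "S \<noteq> {}"
  shows "complex_vector_space (clutching_quotient S F \<psi>)"
proof -
  obtain x where x: "x \<in> S" using assms by blast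
  let ?M = "fiber F x" and ?Q = "clutching_quotient S F \<psi>" and ?p = "clutching_proj S F \<psi>"
  interpret M: Module.module complex_field ?M using fiber_space[OF x] .
  have cf: "c \<in> carrier complex_field" for c :: complex by (simp add: ring_of_type_algebra_def)
  have cl: "?p u \<in> carrier ?Q" if "u \<in> carrier ?M" for u
    using bij_betw_apply[OF class_bij[OF x] that] .
  have ex: "\<exists>u\<in>carrier ?M. P = ?p u" if "P \<in> carrier ?Q" for P
    using that class_bij[OF x] by (auto simp: bij_betw_def)
  note simps = class_add[OF x] class_smult[OF x] class_zero[OF x] cl cf
  show ?thesis
  proof (rule moduleI)
    show "abelian_group ?Q"
    proof (rule abelian_groupI)
      fix P assume "P \<in> carrier ?Q"
      then obtain u where u: "u \<in> carrier ?M" "P = ?p u" using ex by blast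
      then show "\<exists>Q\<in>carrier ?Q. Q \<oplus>\<^bsub>?Q\<^esub> P = \<zero>\<^bsub>?Q\<^esub>"
        by (intro bexI[of _ "?p (\<ominus>\<^bsub>?M\<^esub> u)"]) (simp_all add: simps M.l_neg)
    qed (auto dest!: ex simp: simps M.a_ac)
  qed (auto dest!: ex simp: simps M.R.cring_axioms M.smult_l_distr M.smult_r_distr M.smult_assoc1)
qed

lemma clutching_quotient_unique:
  assumes x: "x \<in> S" and V: "carrier V = carrier (clutching_quotient S F \<psi>)"
    and iso: "restrict (clutching_proj S F \<psi>) (carrier (fiber F x)) \<in> linear_iso (fiber F x) V"
    and P: "P \<in> carrier V" and Q: "Q \<in> carrier V"
  shows "P \<oplus>\<^bsub>V\<^esub> Q = P \<oplus>\<^bsub>clutching_quotient S F \<psi>\<^esub> Q"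
    and "c \<odot>\<^bsub>V\<^esub> P = c \<odot>\<^bsub>clutching_quotient S F \<psi>\<^esub> P"
proof -
  interpret M: Module.module complex_field "fiber F x" using fiber_space[OF x] .
  obtain u v where uv: "u \<in> carrier (fiber F x)" "P = clutching_proj S F \<psi> u"
      "v \<in> carrier (fiber F x)" "Q = clutching_proj S F \<psi> v"
    using P Q unfolding V bij_betw_imp_surj_on[OF class_bij[OF x], symmetric] by blast
  have cu: "c \<odot>\<^bsub>fiber F x\<^esub> u \<in> carrier (fiber F x)"
    using uv by (intro M.smult_closed) (simp_all add: ring_of_type_algebra_def)
  have lin: "restrict (clutching_proj S F \<psi>) (carrier (fiber F x)) \<in> linear_maps (fiber F x) V"
    using iso by (simp add: linear_iso_def)
  show "P \<oplus>\<^bsub>V\<^esub> Q = P \<oplus>\<^bsub>clutching_quotient S F \<psi>\<^esub> Q"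
    using lin uv by (simp add: linear_maps_def class_add[OF x])
  have "restrict (clutching_proj S F \<psi>) (carrier (fiber F x)) (c \<odot>\<^bsub>fiber F x\<^esub> u) =
      c \<odot>\<^bsub>V\<^esub> restrict (clutching_proj S F \<psi>) (carrier (fiber F x)) u"
    using lin uv(1) unfolding linear_maps_def by blast
  then show "c \<odot>\<^bsub>V\<^esub> P = c \<odot>\<^bsub>clutching_quotient S F \<psi>\<^esub> P"
    using uv cu by (simp add: class_smult[OF x])
qed

end

end

theory Submission
  imports Defs
begin

text \<open>
  The action on the quotient is forced to be \<open>\<tau> g (p u) = p (\<rho> g u)\<close>, and this is well defined exactly
  when \<open>\<psi>\<close> is equivariant.  For continuity, choose a fiber \<open>F\<^sub>x\<close> and let \<open>s\<close> be the inverse of the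
  linear isomorphism \<open>p : F\<^sub>x \<rightarrow> F/\<psi>\<close>; then \<open>\<tau> g P = p (\<rho> g (s P))\<close> is a composite of continuous maps,
  because the bundle topology induces the canonical topology on each fiber, and each fiber is open.
\<close>

section \<open>Linear maps and the canonical topology\<close>

lemma carrier_complex_field [simp]: "carrier complex_field = UNIV"
  by (simp add: ring_of_type_algebra_def)

lemma smult_closed_complex:
  "\<lbrakk>complex_vector_space V; u \<in> carrier V\<rbrakk> \<Longrightarrow> c \<odot>\<^bsub>V\<^esub> u \<in> carrier V"
  by (simp add: module.smult_closed)

lemma add_closed_complex:
  assumes "complex_vector_space V" "u \<in> carrier V" "v \<in> carrier V"
  shows "u \<oplus>\<^bsub>V\<^esub> v \<in> carrier V"
proof -
  interpret Module.module complex_field V by fact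
  show ?thesis using assms by simp
qed

lemma linear_mapsD:
  assumes "f \<in> linear_maps V W" "u \<in> carrier V"
  shows "f u \<in> carrier W"
    and "v \<in> carrier V \<Longrightarrow> f (u \<oplus>\<^bsub>V\<^esub> v) = f u \<oplus>\<^bsub>W\<^esub> f v"
    and "f (c \<odot>\<^bsub>V\<^esub> u) = c \<odot>\<^bsub>W\<^esub> f u"
  using assms by (auto simp: linear_maps_def)

lemma linear_maps_compose:
  assumes "complex_vector_space U" "f \<in> linear_maps U V" "g \<in> linear_maps V W"
  shows "compose (carrier U) g f \<in> linear_maps U W"
proof -
  note f = linear_mapsD[OF assms(2)] and g = linear_mapsD[OF assms(3)]
  show ?thesis
    unfolding linear_maps_def
    using assms(1) by (auto simp: compose_def add_closed_complex smult_closed_complex f g)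
qed

lemma linear_iso_compose:
  assumes "complex_vector_space U" "f \<in> linear_iso U V" "g \<in> linear_iso V W"
  shows "compose (carrier U) g f \<in> linear_iso U W"
  using assms linear_maps_compose[OF assms(1), of f V g W] bij_betw_compose[of f _ _ g]
  by (auto simp: linear_iso_def)

text \<open>All computation happens in \<open>V\<close>: elements of \<open>W\<close> are written as
  values of \<open>f\<close>, and closure of \<open>carrier W\<close> under its operations comes out
  together with linearity of the inverse.\<close>

lemma linear_iso_inverse:
  assumes V: "complex_vector_space V" and f: "f \<in> linear_iso V W"
  shows "restrict (inv_into (carrier V) f) (carrier W) \<in> linear_iso W V"
proof -
  let ?h = "inv_into (carrier V) f"
  have lin: "f \<in> linear_maps V W" and bij: "bij_betw f (carrier V) (carrier W)"
    using f by (auto simp: linear_iso_def)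
  have left: "?h (f u) = u" if "u \<in> carrier V" for u
    using bij that by (simp add: bij_betw_inv_into_left)
  have ex: "\<exists>u\<in>carrier V. P = f u" if "P \<in> carrier W" for P
    using bij that by (auto simp: bij_betw_def)
  have add: "?h (P \<oplus>\<^bsub>W\<^esub> Q) = ?h P \<oplus>\<^bsub>V\<^esub> ?h Q \<and> P \<oplus>\<^bsub>W\<^esub> Q \<in> carrier W"
    if PQ: "P \<in> carrier W" "Q \<in> carrier W" for P Q
  proof -
    obtain u v where uv: "u \<in> carrier V" "P = f u" "v \<in> carrier V" "Q = f v" using ex PQ by blast
    then have "P \<oplus>\<^bsub>W\<^esub> Q = f (u \<oplus>\<^bsub>V\<^esub> v)" using linear_mapsD(2)[OF lin] by simp
    then show ?thesis using uv left add_closed_complex[OF V] linear_mapsD(1)[OF lin] by simp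
  qed
  have smult: "?h (c \<odot>\<^bsub>W\<^esub> P) = c \<odot>\<^bsub>V\<^esub> ?h P \<and> c \<odot>\<^bsub>W\<^esub> P \<in> carrier W" if P: "P \<in> carrier W" for c P
  proof -
    obtain u where u: "u \<in> carrier V" "P = f u" using ex P by blast
    then have "c \<odot>\<^bsub>W\<^esub> P = f (c \<odot>\<^bsub>V\<^esub> u)" using linear_mapsD(3)[OF lin] by simp
    then show ?thesis using u left smult_closed_complex[OF V] linear_mapsD(1)[OF lin] by simp
  qed
  have "bij_betw ?h (carrier W) (carrier V)" using bij by (rule bij_betw_inv_into)
  then show ?thesis
    using add smult by (auto simp: linear_iso_def linear_maps_def bij_betw_apply cong: bij_betw_cong)
qed

text \<open>Bridges the projection restricted to a fiber, which is the extensional linear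
  isomorphism, and the unrestricted projection, whose inverse serves as section.\<close>

lemma inv_into_restrict: "inv_into A (restrict f A) = inv_into A f"
  by (simp add: inv_into_def fun_eq_iff cong: conj_cong)

section \<open>Tuple spaces, their linear maps and the canonical topology\<close>

lemma complex_vector_space_cvec: "complex_vector_space (cvec n)"
proof (rule moduleI)
  show "abelian_group (cvec n)"
  proof (rule abelian_groupI)
    fix z assume z: "z \<in> carrier (cvec n)"
    then show "\<exists>w\<in>carrier (cvec n). w \<oplus>\<^bsub>cvec n\<^esub> z = \<zero>\<^bsub>cvec n\<^esub>"
      by (intro bexI[of _ "\<lambda>i. - z i"]) (auto simp: cvec_def)
  qed (auto simp: cvec_def algebra_simps)
qed (use cring_from_type_algebra in \<open>auto simp: cvec_def ring_of_type_algebra_def algebra_simps\<close>)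

text \<open>Expansion in the standard basis: the images of the basis vectors are the columns of the
  matrix of \<open>f\<close>. This form makes continuity visible.\<close>

lemma linear_maps_cvec_eq_sum:
  assumes f: "f \<in> linear_maps (cvec m) (cvec n)" and z: "z \<in> carrier (cvec m)"
  shows "f z = (\<lambda>i. \<Sum>j<m. z j * f (\<lambda>l. if l = j then 1 else 0) i)"
proof -
  \<comment> \<open>Induction on the number \<open>k\<close> of coordinates of \<open>z\<close> that
    are kept; the bound \<open>k \<le> m\<close> keeps each added basis vector inside
    \<open>carrier (cvec m)\<close>.\<close>
  have "f (\<lambda>i. if i < k then z i else 0) = (\<lambda>i. \<Sum>j<k. z j * f (\<lambda>l. if l = j then 1 else 0) i)"
    if "k \<le> m" for k
    using that
  proof (induction k)
    case 0
    \<comment> \<open>The zero vector is written as 0 times itself, so that homogeneity forces its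
      image to be zero.\<close>
    have "f (0 \<odot>\<^bsub>cvec m\<^esub> (\<lambda>i. 0)) = 0 \<odot>\<^bsub>cvec n\<^esub> f (\<lambda>i. 0)"
      by (rule linear_mapsD(3)[OF f]) (simp add: cvec_def)
    then show ?case by (simp add: cvec_def)
  next
    case (Suc k)
    let ?w = "\<lambda>i. if i < k then z i else 0" and ?e = "\<lambda>l. if l = k then 1 else 0 :: complex"
    have e: "?e \<in> carrier (cvec m)" and w: "?w \<in> carrier (cvec m)"
      using Suc.prems by (auto simp: cvec_def)
    have "(\<lambda>i. if i < Suc k then z i else 0) = ?w \<oplus>\<^bsub>cvec m\<^esub> (z k \<odot>\<^bsub>cvec m\<^esub> ?e)"
      by (auto simp: cvec_def fun_eq_iff less_Suc_eq)
    then have "f (\<lambda>i. if i < Suc k then z i else 0) = f ?w \<oplus>\<^bsub>cvec n\<^esub> (z k \<odot>\<^bsub>cvec n\<^esub> f ?e)"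
      using linear_mapsD(2)[OF f w smult_closed_complex[OF complex_vector_space_cvec e]]
        linear_mapsD(3)[OF f e] by simp
    then show ?case using Suc by (simp add: cvec_def)
  qed
  from this[of m] have "f (\<lambda>i. if i < m then z i else 0) = (\<lambda>i. \<Sum>j<m. z j * f (\<lambda>l. if l = j then 1 else 0) i)"
    by simp
  moreover have "(\<lambda>i. if i < m then z i else 0) = z" using z by (auto simp: cvec_def)
  ultimately show ?thesis by simp
qed

text \<open>By the matrix formula each coordinate of \<open>f z\<close> is a finite sum of
  coordinate projections times constants, and continuity into a product is checked
  coordinatewise.\<close>

lemma continuous_map_linear_maps_cvec:
  assumes f: "f \<in> linear_maps (cvec m) (cvec n)"
  shows "continuous_map (cvec_topology m) (cvec_topology n) f"
proof -
  let ?g = "\<lambda>z i. \<Sum>j<m. z j * f (\<lambda>l. if l = j then 1 else 0) i"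
  have "continuous_map (cvec_topology m) euclidean (\<lambda>z. z j * c)" for j :: nat and c :: complex
  proof -
    have coord: "continuous_map (cvec_topology m) euclidean (\<lambda>z. z j)"
      unfolding cvec_topology_def
      by (intro continuous_map_from_subtopology continuous_map_product_projection UNIV_I)
    have mult: "continuous_map euclidean euclidean (\<lambda>t. t * c)"
      by (simp add: continuous_intros)
    show ?thesis using continuous_map_compose[OF coord mult] by (simp add: o_def)
  qed
  then have "continuous_map (cvec_topology m) (product_topology (\<lambda>_. euclidean) UNIV) ?g"
    by (simp add: continuous_map_componentwise_UNIV continuous_map_sum)
  then have "continuous_map (cvec_topology m) (product_topology (\<lambda>_. euclidean) UNIV) f"
    by (rule continuous_map_eq) (simp add: cvec_topology_def linear_maps_cvec_eq_sum[OF f])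
  then show ?thesis
    using linear_mapsD(1)[OF f]
    by (auto simp: cvec_topology_def[of n] continuous_map_in_subtopology)
       (simp add: cvec_topology_def)
qed

text \<open>The canonical topology tests openness against all linear parametrizations by tuples.
  Composing one of \<open>V\<close> with \<open>f\<close> gives one of \<open>W\<close>, so every
  test of the preimage of \<open>U\<close> is a test that \<open>U\<close> already passes.\<close>

lemma continuous_map_linear_iso:
  assumes f: "f \<in> linear_iso V W"
  shows "continuous_map (canonical_topology V) (canonical_topology W) f"
  unfolding continuous_map_alt topspace_canonical_topology
proof (intro conjI allI impI)
  show "f \<in> carrier V \<rightarrow> carrier W" using f by (auto simp: linear_iso_def linear_maps_def)
next
  fix U assume U: "openin (canonical_topology W) U"
  show "openin (canonical_topology V) (f -` U \<inter> carrier V)"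
    unfolding openin_canonical_topology
  proof (intro conjI allI ballI)
    fix n g assume g: "g \<in> linear_iso (cvec n) V"
    have "openin (cvec_topology n) {z \<in> carrier (cvec n). compose (carrier (cvec n)) f g z \<in> U}"
      using U linear_iso_compose[OF complex_vector_space_cvec g f]
      unfolding openin_canonical_topology by blast
    moreover have "g z \<in> carrier V" if "z \<in> carrier (cvec n)" for z
      using g that by (auto simp: linear_iso_def dest: linear_mapsD(1))
    then have "{z \<in> carrier (cvec n). g z \<in> f -` U \<inter> carrier V} =
        {z \<in> carrier (cvec n). compose (carrier (cvec n)) f g z \<in> U}"
      by (auto simp: compose_eq)
    ultimately show "openin (cvec_topology n) {z \<in> carrier (cvec n). g z \<in> f -` U \<inter> carrier V}"
      by simp
  qed simp
qed

text \<open>The identity is one of the parametrizations, so canonically open sets are open.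
  Conversely, every parametrization is a linear map between tuple spaces and hence
  continuous.\<close>

lemma canonical_topology_cvec: "canonical_topology (cvec n) = cvec_topology n"
  unfolding topology_eq
proof (intro allI iffI)
  fix U assume U: "openin (canonical_topology (cvec n)) U"
  have "(\<lambda>z\<in>carrier (cvec n). z) \<in> linear_iso (cvec n) (cvec n)"
    using add_closed_complex[OF complex_vector_space_cvec] smult_closed_complex[OF complex_vector_space_cvec]
    by (auto simp: linear_iso_def linear_maps_def bij_betw_def inj_on_def)
  then have "openin (cvec_topology n) {z \<in> carrier (cvec n). (\<lambda>z\<in>carrier (cvec n). z) z \<in> U}"
    and "U \<subseteq> carrier (cvec n)"
    using U unfolding openin_canonical_topology by blast+
  moreover from this(2) have "{z \<in> carrier (cvec n). (\<lambda>z\<in>carrier (cvec n). z) z \<in> U} = U" by auto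
  ultimately show "openin (cvec_topology n) U" by simp
next
  fix U assume U: "openin (cvec_topology n) U"
  have top: "topspace (cvec_topology k) = carrier (cvec k)" for k by (simp add: cvec_topology_def)
  show "openin (canonical_topology (cvec n)) U"
    unfolding openin_canonical_topology
  proof (intro conjI allI ballI)
    show "U \<subseteq> carrier (cvec n)" using openin_subset[OF U] by (simp add: top)
  next
    fix m f assume "f \<in> linear_iso (cvec m) (cvec n)"
    then have "continuous_map (cvec_topology m) (cvec_topology n) f"
      by (simp add: linear_iso_def continuous_map_linear_maps_cvec)
    from openin_continuous_map_preimage[OF this U]
    show "openin (cvec_topology m) {z \<in> carrier (cvec m). f z \<in> U}" by (simp add: top)
  qed
qed

lemma homeomorphic_map_linear_iso:
  assumes V: "complex_vector_space V" and f: "f \<in> linear_iso V W"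
  shows "homeomorphic_map (canonical_topology V) (canonical_topology W) f"
proof -
  let ?h = "restrict (inv_into (carrier V) f) (carrier W)"
  have bij: "bij_betw f (carrier V) (carrier W)" using f by (simp add: linear_iso_def)
  have "homeomorphic_maps (canonical_topology V) (canonical_topology W) f ?h"
    using continuous_map_linear_iso[OF f] continuous_map_linear_iso[OF linear_iso_inverse[OF V f]] bij
    by (auto simp: homeomorphic_maps_def topspace_canonical_topology bij_betw_inv_into_left
        bij_betw_inv_into_right dest: bij_betw_apply)
  then show ?thesis using homeomorphic_map_maps by blast
qed


section \<open>Vector bundles over discrete spaces\<close>

text \<open>A local trivialization \<open>h\<close> identifies the fiber over \<open>x\<close> with
  the slice of pairs \<open>(x, z)\<close>. Its second component is therefore one map
  \<open>k\<close> that is both a linear and a topological coordinate system; the inverse sends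
  \<open>z\<close> to \<open>h' (x, z)\<close>.\<close>

lemma vector_bundle_fiber_trivialization:
  assumes F: "vector_bundle B F" and x: "x \<in> topspace B"
  obtains n k where "k \<in> linear_iso (fiber F x) (cvec n)"
    and "homeomorphic_map (subtopology (total_space F) (carrier (fiber F x))) (cvec_topology n) k"
proof -
  let ?E = "total_space F" and ?C = "carrier (fiber F x)"
  from F x have "\<exists>U n h. openin B U \<and> x \<in> U \<and>
      homeomorphic_map (subtopology ?E {u \<in> topspace ?E. bundle_proj F u \<in> U})
        (prod_topology (subtopology B U) (cvec_topology n)) h \<and>
      (\<forall>y\<in>U. (\<forall>u\<in>carrier (fiber F y). fst (h u) = y) \<and>
         restrict (snd \<circ> h) (carrier (fiber F y)) \<in> linear_iso (fiber F y) (cvec n))"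
    unfolding vector_bundle_def by (elim conjE) (rule bspec)
  then obtain U n h where U: "openin B U" "x \<in> U"
    and h: "homeomorphic_map (subtopology ?E {u \<in> topspace ?E. bundle_proj F u \<in> U})
          (prod_topology (subtopology B U) (cvec_topology n)) h"
    and lin: "\<forall>y\<in>U. (\<forall>u\<in>carrier (fiber F y). fst (h u) = y) \<and>
          restrict (snd \<circ> h) (carrier (fiber F y)) \<in> linear_iso (fiber F y) (cvec n)"
    by (elim exE conjE) (rule that)
  have fst_h: "\<forall>u\<in>?C. fst (h u) = x"
    and iso: "restrict (snd \<circ> h) ?C \<in> linear_iso (fiber F x) (cvec n)"
    using bspec[OF lin U(2)] by simp_all
  let ?X = "subtopology ?E {u \<in> topspace ?E. bundle_proj F u \<in> U}"
    and ?Y = "prod_topology (subtopology B U) (cvec_topology n)"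
    and ?k = "restrict (snd \<circ> h) ?C"
  obtain h' where h': "homeomorphic_maps ?X ?Y h h'" using h homeomorphic_map_maps by blast
  have C: "?C = {u \<in> topspace ?E. bundle_proj F u = x}" using F x by (simp add: vector_bundle_def)
  have top: "topspace (cvec_topology n) = carrier (cvec n)" by (simp add: cvec_topology_def)
  \<comment> \<open>The fiber lies over \<open>U\<close>, so restricting first to the part over
    \<open>U\<close> changes nothing; continuity of \<open>h\<close> and \<open>h'\<close> can thus
    be transferred to the fiber.\<close>
  have sub: "subtopology ?X ?C = subtopology ?E ?C"
    using U(2) by (auto simp: subtopology_subtopology C intro: arg_cong)
  have bij: "bij_betw ?k ?C (carrier (cvec n))" using iso by (simp add: linear_iso_def)
  have hC: "h u = (x, ?k u)" "h' (x, ?k u) = u" if u: "u \<in> ?C" for u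
  proof -
    show eq: "h u = (x, ?k u)" using fst_h u by (auto simp: prod_eq_iff)
    have "u \<in> topspace ?X" using u U(2) by (simp add: C)
    then have "h' (h u) = u" using h' by (simp add: homeomorphic_maps_def)
    then show "h' (x, ?k u) = u" by (simp only: eq)
  qed
  have hi: "h' (x, z) \<in> ?C" "?k (h' (x, z)) = z" if z: "z \<in> carrier (cvec n)" for z
  proof -
    \<comment> \<open>Surjectivity of the linear coordinate map supplies \<open>u\<close>, and
      \<open>h' (x, z)\<close> is this \<open>u\<close>.\<close>
    obtain u where "u \<in> ?C" "?k u = z" using bij z by (metis bij_betw_imp_surj_on imageE)
    then show "h' (x, z) \<in> ?C" "?k (h' (x, z)) = z" using hC(2)[of u] by (simp_all only:)
  qed
  have "continuous_map (subtopology ?E ?C) (cvec_topology n) (snd \<circ> h)"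
    unfolding sub[symmetric]
    using continuous_map_compose[OF homeomorphic_imp_continuous_map[OF h] continuous_map_snd]
    by (rule continuous_map_from_subtopology)
  then have k: "continuous_map (subtopology ?E ?C) (cvec_topology n) ?k"
    by (rule continuous_map_eq) auto
  have "continuous_map (cvec_topology n) ?Y (\<lambda>z. (x, z))"
    using U(2) x by (intro continuous_map_pairedI) auto
  moreover have "continuous_map ?Y ?X h'" using h' by (simp add: homeomorphic_maps_def)
  ultimately have "continuous_map (cvec_topology n) ?X (h' \<circ> (\<lambda>z. (x, z)))"
    by (rule continuous_map_compose)
  then have "continuous_map (cvec_topology n) ?X (\<lambda>z. h' (x, z))" by (simp add: o_def)
  then have k': "continuous_map (cvec_topology n) (subtopology ?E ?C) (\<lambda>z. h' (x, z))"
    using hi(1) unfolding sub[symmetric] continuous_map_in_subtopology by (auto simp: top)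
  have "homeomorphic_maps (subtopology ?E ?C) (cvec_topology n) ?k (\<lambda>z. h' (x, z))"
    unfolding homeomorphic_maps_def using k k' hC(2) hi(2) by (auto simp: top)
  then show thesis using that[OF iso] homeomorphic_map_maps by blast
qed

text \<open>The same map \<open>k\<close> is a homeomorphism onto \<open>cvec_topology n\<close> for
  both topologies, so they have the same open sets.\<close>

lemma subtopology_fiber:
  assumes F: "vector_bundle B F" and x: "x \<in> topspace B"
  shows "subtopology (total_space F) (carrier (fiber F x)) = canonical_topology (fiber F x)"
    (is "?X = ?Y")
proof -
  obtain n k where k: "k \<in> linear_iso (fiber F x) (cvec n)"
      "homeomorphic_map ?X (cvec_topology n) k"
    using vector_bundle_fiber_trivialization[OF assms] .
  have V: "complex_vector_space (fiber F x)" and "carrier (fiber F x) \<subseteq> topspace (total_space F)"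
    using assms by (auto simp: vector_bundle_def)
  then have top: "topspace ?X = carrier (fiber F x)" by auto
  have k': "homeomorphic_map ?Y (cvec_topology n) k"
    using homeomorphic_map_linear_iso[OF V k(1)] by (simp add: canonical_topology_cvec)
  show ?thesis
    unfolding topology_eq
    using homeomorphic_map_openness[OF k(2)] homeomorphic_map_openness[OF k'] openin_subset
    by (metis top topspace_canonical_topology)
qed


section \<open>The quotient by a pointwise clutching map\<close>

context
  fixes S :: "'x set" and F :: "('x, 'f) complex_bundle"
  assumes F: "vector_bundle (discrete_topology S) F"
begin

lemma mem_fiber_iff:
  "x \<in> S \<Longrightarrow> u \<in> carrier (fiber F x) \<longleftrightarrow> u \<in> topspace (total_space F) \<and> bundle_proj F u = x"
  using F by (simp add: vector_bundle_def)

lemma fiber_vector_space: "x \<in> S \<Longrightarrow> complex_vector_space (fiber F x)"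
  using F by (simp add: vector_bundle_def)

lemma mem_total_spaceE:
  assumes "u \<in> topspace (total_space F)"
  obtains x where "x \<in> S" "u \<in> carrier (fiber F x)"
proof -
  have "bundle_proj F \<in> topspace (total_space F) \<rightarrow> S"
    using F by (force simp: vector_bundle_def dest: continuous_map_funspace)
  with assms that mem_fiber_iff show thesis by blast
qed

text \<open>Points of the discrete base are open. Hence sets open in a fiber are open in the total
  space.\<close>

lemma openin_fiber:
  assumes x: "x \<in> S"
  shows "openin (total_space F) (carrier (fiber F x))"
proof -
  have "continuous_map (total_space F) (discrete_topology S) (bundle_proj F)"
    using F by (simp add: vector_bundle_def)
  from openin_continuous_map_preimage[OF this, of "{x}"]
  have "openin (total_space F) {u \<in> topspace (total_space F). bundle_proj F u \<in> {x}}" using x by simp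
  moreover have "carrier (fiber F x) = {u \<in> topspace (total_space F). bundle_proj F u \<in> {x}}"
    using mem_fiber_iff[OF x] by blast
  ultimately show ?thesis by simp
qed

context
  fixes \<psi> :: "'x \<times> 'x \<Rightarrow> 'f \<Rightarrow> 'f"
  assumes \<psi>: "pointwise_clutching_map S F \<psi>"
begin

section \<open>Classes of the clutching relation, and the topology of the projection and its
  sections\<close>

lemma clutching_map_linear_iso:
  assumes "x \<in> S" "x' \<in> S"
  shows "\<psi> (x, x') \<in> linear_iso (fiber F x) (fiber F x')"
proof -
  have "\<psi> \<in> (\<Pi>\<^sub>E (x, x')\<in>S \<times> S. linear_iso (fiber F x) (fiber F x'))"
    using \<psi> by (simp add: pointwise_clutching_map_def)
  then show ?thesis using assms by (force dest: PiE_mem[of _ _ _ "(x, x')"])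
qed

lemma clutching_map_closed:
  "\<lbrakk>x \<in> S; x' \<in> S; u \<in> carrier (fiber F x)\<rbrakk> \<Longrightarrow> \<psi> (x, x') u \<in> carrier (fiber F x')"
  using clutching_map_linear_iso[of x x'] by (auto simp: linear_iso_def linear_maps_def)

lemma clutching_map_comp:
  assumes "x \<in> S" "x' \<in> S" "x'' \<in> S" "u \<in> carrier (fiber F x)"
  shows "\<psi> (x', x'') (\<psi> (x, x') u) = \<psi> (x, x'') u"
proof -
  have "\<psi> (x, x'') = compose (carrier (fiber F x)) (\<psi> (x', x'')) (\<psi> (x, x'))"
    using \<psi> assms(1-3) unfolding pointwise_clutching_map_def by blast
  then show ?thesis using assms by (simp add: compose_def)
qed

text \<open>Distinct fibers are disjoint, so \<open>u\<close> determines \<open>x\<close>, and the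
  class of \<open>u\<close> consists of one representative in each fiber.\<close>

lemma clutching_proj_eq_image:
  assumes "x \<in> S" "u \<in> carrier (fiber F x)"
  shows "clutching_proj S F \<psi> u = (\<lambda>x'. \<psi> (x, x') u) ` S"
proof -
  have "y = x" if "y \<in> S" "u \<in> carrier (fiber F y)" for y
    using assms that by (simp add: mem_fiber_iff)
  then show ?thesis
    using assms clutching_map_closed[of x _ u]
    unfolding clutching_proj_def clutching_rel_def by blast
qed

text \<open>By the cocycle condition both classes list the same representatives.\<close>

lemma clutching_proj_clutching_map:
  assumes "x \<in> S" "x' \<in> S" "u \<in> carrier (fiber F x)"
  shows "clutching_proj S F \<psi> (\<psi> (x, x') u) = clutching_proj S F \<psi> u"
  unfolding clutching_proj_eq_image[OF assms(2) clutching_map_closed[OF assms]]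
    clutching_proj_eq_image[OF assms(1,3)]
  by (intro image_cong refl clutching_map_comp assms)

lemma clutching_proj_bij_betw:
  assumes "x \<in> S"
  shows "bij_betw (clutching_proj S F \<psi>) (carrier (fiber F x)) (carrier (clutching_quotient S F \<psi>))"
  using clutching_proj_linear_iso[OF F \<psi> assms] by (simp add: linear_iso_def cong: bij_betw_cong)

lemma clutching_proj_closed:
  "u \<in> topspace (total_space F) \<Longrightarrow> clutching_proj S F \<psi> u \<in> carrier (clutching_quotient S F \<psi>)"
  by (metis mem_total_spaceE bij_betw_apply clutching_proj_bij_betw)

text \<open>On each fiber the projection is a linear isomorphism, hence continuous for the canonical
  topology, which is the subspace topology. The preimage of an open set is the union of its parts in
  the fibers, and these are open because the fibers are.\<close>

lemma continuous_map_clutching_proj: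
  "continuous_map (total_space F) (canonical_topology (clutching_quotient S F \<psi>)) (clutching_proj S F \<psi>)"
  unfolding continuous_map_alt topspace_canonical_topology
proof (intro conjI allI impI)
  show "clutching_proj S F \<psi> \<in> topspace (total_space F) \<rightarrow> carrier (clutching_quotient S F \<psi>)"
    using clutching_proj_closed by blast
next
  let ?p = "clutching_proj S F \<psi>"
  fix U assume U: "openin (canonical_topology (clutching_quotient S F \<psi>)) U"
  have "openin (total_space F) {u \<in> carrier (fiber F x). ?p u \<in> U}" if x: "x \<in> S" for x
  proof -
    let ?C = "carrier (fiber F x)"
    have "openin (canonical_topology (fiber F x)) {u \<in> ?C. restrict ?p ?C u \<in> U}"
      using openin_continuous_map_preimage[OF
          continuous_map_linear_iso[OF clutching_proj_linear_iso[OF F \<psi> x]] U]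
      by (simp add: topspace_canonical_topology)
    moreover have "{u \<in> ?C. restrict ?p ?C u \<in> U} = {u \<in> ?C. ?p u \<in> U}" by auto
    moreover have "canonical_topology (fiber F x) = subtopology (total_space F) ?C"
      using subtopology_fiber[OF F] x by simp
    ultimately show ?thesis using openin_fiber[OF x] by (simp add: openin_open_subtopology)
  qed
  then have "openin (total_space F) (\<Union>x\<in>S. {u \<in> carrier (fiber F x). ?p u \<in> U})" by blast
  moreover have "?p -` U \<inter> topspace (total_space F) = (\<Union>x\<in>S. {u \<in> carrier (fiber F x). ?p u \<in> U})"
    by (auto simp: mem_fiber_iff elim: mem_total_spaceE)
  ultimately show "openin (total_space F) (?p -` U \<inter> topspace (total_space F))" by simp
qed

text \<open>The inverse of the linear isomorphism from the fiber is continuous into the fiber, which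
  carries the subspace topology of the total space.\<close>

lemma continuous_map_clutching_section:
  assumes x: "x \<in> S"
  shows "continuous_map (canonical_topology (clutching_quotient S F \<psi>)) (total_space F)
           (inv_into (carrier (fiber F x)) (clutching_proj S F \<psi>))"
proof -
  let ?C = "carrier (fiber F x)" and ?Q = "clutching_quotient S F \<psi>" and ?p = "clutching_proj S F \<psi>"
  have "continuous_map (canonical_topology ?Q) (subtopology (total_space F) ?C)
      (restrict (inv_into ?C (restrict ?p ?C)) (carrier ?Q))"
    using continuous_map_linear_iso[OF linear_iso_inverse[OF fiber_vector_space[OF x]
        clutching_proj_linear_iso[OF F \<psi> x]]] subtopology_fiber[OF F] x by simp
  then have "continuous_map (canonical_topology ?Q) (total_space F)
      (restrict (inv_into ?C (restrict ?p ?C)) (carrier ?Q))"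
    by (simp add: continuous_map_in_subtopology)
  then show ?thesis
    by (rule continuous_map_eq) (simp add: topspace_canonical_topology inv_into_restrict)
qed

text \<open>Linear coordinates of a single fiber are carried over by the projection.\<close>

lemma fin_dim_clutching_quotient:
  assumes x: "x \<in> S"
  shows "fin_dim (clutching_quotient S F \<psi>)"
proof -
  obtain n k where "k \<in> linear_iso (fiber F x) (cvec n)"
    using vector_bundle_fiber_trivialization[OF F] x by (metis topspace_discrete_topology)
  from linear_iso_compose[OF complex_vector_space_cvec
      linear_iso_inverse[OF fiber_vector_space[OF x] this] clutching_proj_linear_iso[OF F \<psi> x]]
  show ?thesis unfolding fin_dim_def by blast
qed

end

end


section \<open>Equivariance\<close>

context
  fixes G :: "('g, 'm) monoid_scheme" and T :: "'g topology"
    and S :: "'x set" and \<phi> :: "'g \<Rightarrow> 'x \<Rightarrow> 'x"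
    and F :: "('x, 'f) complex_bundle" and \<rho> :: "'g \<Rightarrow> 'f \<Rightarrow> 'f"
    and \<psi> :: "'x \<times> 'x \<Rightarrow> 'f \<Rightarrow> 'f"
  assumes G: "group G"
    and S: "S \<noteq> {}"
    and \<phi>: "continuous_action G T (discrete_topology S) \<phi>"
    and F\<rho>: "equivariant_vector_bundle G T (discrete_topology S) \<phi> F \<rho>"
    and \<psi>: "pointwise_clutching_map S F \<psi>"
begin

section \<open>The group actions on base and total space, and the two directions of the
  equivalence\<close>

lemma underlying_bundle: "vector_bundle (discrete_topology S) F"
  using F\<rho> by (simp add: equivariant_vector_bundle_def)

lemma group_action_base: "group_action G S \<phi>"
  using \<phi> by (simp add: continuous_action_def)

lemma group_action_total: "group_action G (topspace (total_space F)) \<rho>"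
  using F\<rho> by (simp add: equivariant_vector_bundle_def continuous_action_def)

lemma action_closed: "\<lbrakk>g \<in> carrier G; x \<in> S\<rbrakk> \<Longrightarrow> \<phi> g x \<in> S"
  using group_action.element_image[OF group_action_base] by blast

lemma total_action_closed:
  "\<lbrakk>g \<in> carrier G; u \<in> topspace (total_space F)\<rbrakk> \<Longrightarrow> \<rho> g u \<in> topspace (total_space F)"
  using group_action.element_image[OF group_action_total] by blast

lemma action_linear:
  "\<lbrakk>g \<in> carrier G; x \<in> S\<rbrakk> \<Longrightarrow>
     restrict (\<rho> g) (carrier (fiber F x)) \<in> linear_maps (fiber F x) (fiber F (\<phi> g x))"
  using F\<rho> by (simp add: equivariant_vector_bundle_def)

lemma action_fiber:
  assumes "g \<in> carrier G" "x \<in> S" "u \<in> carrier (fiber F x)"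
  shows "\<rho> g u \<in> carrier (fiber F (\<phi> g x))"
  using linear_mapsD(1)[OF action_linear[OF assms(1,2)] assms(3)] assms(3) by simp

text \<open>One fiber already maps onto the quotient, so equivariance of the projection prescribes
  every value on the carrier. Off the carrier both maps are \<open>undefined\<close>, linear maps
  being extensional.\<close>

lemma quotient_representation_unique:
  assumes "quotient_representation G T S F \<rho> \<psi> \<tau>" "quotient_representation G T S F \<rho> \<psi> \<tau>'"
    and g: "g \<in> carrier G"
  shows "\<tau> g = \<tau>' g"
proof
  fix P
  let ?Q = "clutching_quotient S F \<psi>"
  obtain x where x: "x \<in> S" using S by blast
  have \<tau>: "\<tau> g \<in> linear_maps ?Q ?Q" "\<tau>' g \<in> linear_maps ?Q ?Q"
    using assms by (auto simp: quotient_representation_def complex_representation_def)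
  show "\<tau> g P = \<tau>' g P"
  proof (cases "P \<in> carrier ?Q")
    case True
    then obtain u where "u \<in> carrier (fiber F x)" "P = clutching_proj S F \<psi> u"
      using clutching_proj_bij_betw[OF underlying_bundle \<psi> x] by (auto simp: bij_betw_def)
    then show ?thesis
      using assms mem_fiber_iff[OF underlying_bundle x] by (auto simp: quotient_representation_def)
  next
    case False
    then show ?thesis using \<tau> by (auto simp: linear_maps_def PiE_def extensional_def)
  qed
qed

text \<open>Both sides of the equivariance equation lie in the fiber over \<open>x'\<close> and have
  the same class; the projection is injective on that fiber.\<close>

lemma equivariant_if_quotient_representation:
  assumes \<tau>: "quotient_representation G T S F \<rho> \<psi> \<tau>"
  shows "equivariant_clutching_map G S \<phi> F \<rho> \<psi>"
  unfolding equivariant_clutching_map_def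
proof
  fix g assume g: "g \<in> carrier G"
  interpret group G by (fact G)
  interpret \<phi>: group_action G S \<phi> by (fact group_action_base)
  interpret \<rho>: group_action G "topspace (total_space F)" \<rho> by (fact group_action_total)
  let ?p = "clutching_proj S F \<psi>" and ?i = "inv\<^bsub>G\<^esub> g"
  have i: "?i \<in> carrier G" using g by simp
  have p\<rho>: "?p (\<rho> h u) = \<tau> h (?p u)" if "h \<in> carrier G" "u \<in> carrier (fiber F x)" "x \<in> S" for h u x
    using \<tau> that mem_fiber_iff[OF underlying_bundle, of x u] by (simp add: quotient_representation_def)
  have gi: "\<phi> g (\<phi> ?i x) = x" if "x \<in> S" for x
    using \<phi>.orbit_sym_aux[OF i that refl] g by simp
  have main: "\<rho> g (\<psi> (\<phi> ?i x, \<phi> ?i x') (\<rho> ?i u)) = \<psi> (x, x') u"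
    if x: "x \<in> S" "x' \<in> S" and u: "u \<in> carrier (fiber F x)" for x x' u
  proof -
    let ?v = "\<psi> (\<phi> ?i x, \<phi> ?i x') (\<rho> ?i u)"
    have S': "\<phi> ?i x \<in> S" "\<phi> ?i x' \<in> S" using action_closed i x by auto
    have \<rho>u: "\<rho> ?i u \<in> carrier (fiber F (\<phi> ?i x))" using action_fiber[OF i x(1) u] .
    have v: "?v \<in> carrier (fiber F (\<phi> ?i x'))" using clutching_map_closed[OF underlying_bundle \<psi> S' \<rho>u] .
    have "u \<in> topspace (total_space F)" using u mem_fiber_iff[OF underlying_bundle x(1)] by blast
    then have \<rho>\<rho>: "\<rho> g (\<rho> ?i u) = u" using \<rho>.orbit_sym_aux[OF i _ refl] g by simp
    \<comment> \<open>Classes absorb \<psi>, and \<tau> turns the action on vectors into one on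
      classes; what remains is \<open>g\<close> cancelling its inverse on \<open>u\<close>.\<close>
    have "?p (\<rho> g ?v) = \<tau> g (?p ?v)" using p\<rho>[OF g v S'(2)] .
    also have "?p ?v = ?p (\<rho> ?i u)" using clutching_proj_clutching_map[OF underlying_bundle \<psi> S' \<rho>u] .
    also have "\<tau> g (?p (\<rho> ?i u)) = ?p u" using p\<rho>[OF g \<rho>u S'(1)] \<rho>\<rho> by simp
    also have "?p u = ?p (\<psi> (x, x') u)" using clutching_proj_clutching_map[OF underlying_bundle \<psi> x u] by simp
    finally have "?p (\<rho> g ?v) = ?p (\<psi> (x, x') u)" .
    moreover have "\<rho> g ?v \<in> carrier (fiber F x')"
      using action_fiber[OF g S'(2) v] gi[OF x(2)] by simp
    moreover have "\<psi> (x, x') u \<in> carrier (fiber F x')"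
      using clutching_map_closed[OF underlying_bundle \<psi> x u] .
    ultimately show ?thesis
      using clutching_proj_bij_betw[OF underlying_bundle \<psi> x(2)] by (meson bij_betw_def inj_onD)
  qed
  show "clutching_action G S \<phi> F \<rho> g \<psi> = \<psi>"
  proof
    fix xx
    show "clutching_action G S \<phi> F \<rho> g \<psi> xx = \<psi> xx"
    proof (cases "xx \<in> S \<times> S")
      case True
      then obtain x x' where x: "xx = (x, x')" "x \<in> S" "x' \<in> S" by blast
      \<comment> \<open>Equality of functions needs the values off the fiber too; there both sides
        are \<open>undefined\<close>.\<close>
      have "\<psi> (x, x') \<in> extensional (carrier (fiber F x))"
        using clutching_map_linear_iso[OF underlying_bundle \<psi> x(2,3)]
        by (auto simp: linear_iso_def linear_maps_def PiE_def)
      then have "\<psi> (x, x') = restrict (\<psi> (x, x')) (carrier (fiber F x))"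
        by (simp add: extensional_restrict)
      also have "\<dots> = clutching_action G S \<phi> F \<rho> g \<psi> (x, x')"
        using x(2,3) main[OF x(2,3)] by (simp add: clutching_action_def cong: restrict_cong)
      finally show ?thesis using x(1) by simp
    next
      case False
      have "\<psi> \<in> extensional (S \<times> S)"
        using \<psi> by (auto simp: pointwise_clutching_map_def PiE_def)
      then have "\<psi> xx = undefined" using False by (rule extensional_arb)
      moreover have "clutching_action G S \<phi> F \<rho> g \<psi> xx = undefined"
        unfolding clutching_action_def unfolding restrict_def using False by (rule if_not_P)
      ultimately show ?thesis by simp
    qed
  qed
qed

text \<open>The inverse-free form of equivariance: evaluate the transformed clutching map at the
  translated points and vector, where the inverses in its definition cancel.\<close>

lemma clutching_map_equivariant:
  assumes eq: "equivariant_clutching_map G S \<phi> F \<rho> \<psi>"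
    and g: "g \<in> carrier G" and x: "x \<in> S" "x' \<in> S" and u: "u \<in> carrier (fiber F x)"
  shows "\<psi> (\<phi> g x, \<phi> g x') (\<rho> g u) = \<rho> g (\<psi> (x, x') u)"
proof -
  interpret \<phi>: group_action G S \<phi> by (fact group_action_base)
  interpret \<rho>: group_action G "topspace (total_space F)" \<rho> by (fact group_action_total)
  have "\<phi> (inv\<^bsub>G\<^esub> g) (\<phi> g x) = x" "\<phi> (inv\<^bsub>G\<^esub> g) (\<phi> g x') = x'"
    using \<phi>.orbit_sym_aux[OF g _ refl] x by auto
  moreover have "\<rho> (inv\<^bsub>G\<^esub> g) (\<rho> g u) = u"
    using \<rho>.orbit_sym_aux[OF g _ refl] u mem_fiber_iff[OF underlying_bundle x(1)] by blast
  moreover have "clutching_action G S \<phi> F \<rho> g \<psi> (\<phi> g x, \<phi> g x') (\<rho> g u)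
      = \<psi> (\<phi> g x, \<phi> g x') (\<rho> g u)"
    using eq g by (simp add: equivariant_clutching_map_def)
  ultimately show ?thesis
    using action_closed[OF g] action_fiber[OF g x(1) u] x by (simp add: clutching_action_def)
qed

lemma quotient_representation_exists:
  assumes eq: "equivariant_clutching_map G S \<phi> F \<rho> \<psi>"
  obtains \<tau> where "quotient_representation G T S F \<rho> \<psi> \<tau>"
proof -
  obtain x0 where x0: "x0 \<in> S" using S by blast
  interpret group G by (fact G)
  interpret \<rho>: group_action G "topspace (total_space F)" \<rho> by (fact group_action_total)
  let ?p = "clutching_proj S F \<psi>" and ?Q = "clutching_quotient S F \<psi>"
  define s where "s = inv_into (carrier (fiber F x0)) ?p"
  \<comment> \<open>Lift to the fiber over \<open>x0\<close>, act, and project. The restriction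
    makes \<open>\<tau> g\<close> extensional, as \<open>linear_maps\<close> and \<open>Bij\<close>
    demand.\<close>
  define \<tau> where "\<tau> g = (\<lambda>P\<in>carrier ?Q. ?p (\<rho> g (s P)))" for g
  have bij: "bij_betw ?p (carrier (fiber F x0)) (carrier ?Q)"
    using clutching_proj_bij_betw[OF underlying_bundle \<psi> x0] .
  have ps: "?p (s P) = P" and s: "s P \<in> carrier (fiber F x0)" if "P \<in> carrier ?Q" for P
    using bij that bij_betw_inv_into[OF bij]
    by (auto simp: s_def bij_betw_inv_into_right dest: bij_betw_apply)
  have s': "s P \<in> topspace (total_space F)" if "P \<in> carrier ?Q" for P
    using s[OF that] mem_fiber_iff[OF underlying_bundle x0] by blast
  note pc = clutching_proj_closed[OF underlying_bundle \<psi>]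
  \<comment> \<open>Here equivariance enters: the section replaces \<open>u\<close> by its
    representative over \<open>x0\<close>, and moving \<open>\<rho> g\<close> past \<psi> shows that
    this leaves the resulting class unchanged.\<close>
  have \<tau>p: "?p (\<rho> g u) = \<tau> g (?p u)" if g: "g \<in> carrier G" and u: "u \<in> topspace (total_space F)" for g u
  proof -
    obtain x where x: "x \<in> S" "u \<in> carrier (fiber F x)" using mem_total_spaceE[OF underlying_bundle u] .
    have "?p (\<psi> (x, x0) u) = ?p u" using clutching_proj_clutching_map[OF underlying_bundle \<psi> x(1) x0 x(2)] .
    then have "s (?p u) = \<psi> (x, x0) u"
      using bij_betw_inv_into_left[OF bij clutching_map_closed[OF underlying_bundle \<psi> x(1) x0 x(2)]]
      by (simp add: s_def)
    then have "\<tau> g (?p u) = ?p (\<rho> g (\<psi> (x, x0) u))" using pc[OF u] by (simp add: \<tau>_def)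
    also have "\<dots> = ?p (\<psi> (\<phi> g x, \<phi> g x0) (\<rho> g u))"
      using clutching_map_equivariant[OF eq g x(1) x0 x(2)] by simp
    also have "\<dots> = ?p (\<rho> g u)"
      using clutching_proj_clutching_map[OF underlying_bundle \<psi> action_closed[OF g x(1)] action_closed[OF g x0]
          action_fiber[OF g x]] .
    finally show ?thesis by simp
  qed
  have \<tau>_closed: "\<tau> g P \<in> carrier ?Q" if "g \<in> carrier G" "P \<in> carrier ?Q" for g P
    using pc total_action_closed s' that by (simp add: \<tau>_def)
  \<comment> \<open>The vector \<open>\<rho> h (s P)\<close> may leave the fiber over
    \<open>x0\<close>, so \<open>\<tau>p\<close> is needed on the whole total space.\<close>
  have \<tau>_mult: "\<tau> (g \<otimes>\<^bsub>G\<^esub> h) P = \<tau> g (\<tau> h P)"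
    if gh: "g \<in> carrier G" "h \<in> carrier G" and P: "P \<in> carrier ?Q" for g h P
  proof -
    have "\<tau> (g \<otimes>\<^bsub>G\<^esub> h) P = ?p (\<rho> g (\<rho> h (s P)))"
      using gh P \<rho>.composition_rule[OF s'[OF P]] by (simp add: \<tau>_def)
    also have "\<dots> = \<tau> g (?p (\<rho> h (s P)))" using \<tau>p gh total_action_closed s'[OF P] by simp
    also have "?p (\<rho> h (s P)) = \<tau> h P" using P by (simp add: \<tau>_def)
    finally show ?thesis .
  qed
  have \<tau>_one: "\<tau> \<one>\<^bsub>G\<^esub> P = P" if P: "P \<in> carrier ?Q" for P
  proof -
    have "\<rho> \<one>\<^bsub>G\<^esub> (s P) = s P" using \<rho>.id_eq_one s'[OF P] by (metis restrict_apply')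
    then show ?thesis using P ps by (simp add: \<tau>_def)
  qed
  have \<tau>_Bij: "\<tau> g \<in> Bij (carrier ?Q)" if g: "g \<in> carrier G" for g
  proof -
    have "bij_betw (\<tau> g) (carrier ?Q) (carrier ?Q)"
    proof (rule bij_betwI)
      show "\<tau> g \<in> carrier ?Q \<rightarrow> carrier ?Q" "\<tau> (inv\<^bsub>G\<^esub> g) \<in> carrier ?Q \<rightarrow> carrier ?Q"
        using \<tau>_closed g by auto
    next
      fix P assume P: "P \<in> carrier ?Q"
      show "\<tau> (inv\<^bsub>G\<^esub> g) (\<tau> g P) = P" "\<tau> g (\<tau> (inv\<^bsub>G\<^esub> g) P) = P"
        using g P \<tau>_mult[of "inv\<^bsub>G\<^esub> g" g P] \<tau>_mult[of g "inv\<^bsub>G\<^esub> g" P] \<tau>_one by simp_all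
    qed
    then show ?thesis by (simp add: Bij_def \<tau>_def)
  qed
  have "\<tau> (g \<otimes>\<^bsub>G\<^esub> h) = compose (carrier ?Q) (\<tau> g) (\<tau> h)" if "g \<in> carrier G" "h \<in> carrier G" for g h
  proof
    fix P
    have "P \<notin> carrier ?Q \<Longrightarrow> \<tau> (g \<otimes>\<^bsub>G\<^esub> h) P = undefined" by (simp add: \<tau>_def)
    then show "\<tau> (g \<otimes>\<^bsub>G\<^esub> h) P = compose (carrier ?Q) (\<tau> g) (\<tau> h) P"
      using \<tau>_mult[OF that] by (cases "P \<in> carrier ?Q") (simp_all add: compose_def)
  qed
  then have action: "group_action G (carrier ?Q) \<tau>"
    using G \<tau>_Bij group_BijGroup
    by (auto simp: group_action_def group_hom_def group_hom_axioms_def hom_def BijGroup_def)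
  have lin: "\<tau> g \<in> linear_maps ?Q ?Q" if g: "g \<in> carrier G" for g
  proof -
    \<comment> \<open>Since \<open>\<rho> g\<close> moves the fiber over \<open>x0\<close> to the
      one over \<open>\<phi> g x0\<close>, the map \<open>\<tau> g\<close> factors through two
      fibers: section at \<open>x0\<close>, then \<open>\<rho> g\<close>, then projection from
      \<open>\<phi> g x0\<close>.\<close>
    let ?C = "carrier (fiber F x0)" and ?D = "carrier (fiber F (\<phi> g x0))"
    have p0: "restrict ?p ?C \<in> linear_iso (fiber F x0) ?Q"
      and pg: "restrict ?p ?D \<in> linear_iso (fiber F (\<phi> g x0)) ?Q"
      using clutching_proj_linear_iso[OF underlying_bundle \<psi>] x0 action_closed[OF g] by auto
    have Q: "complex_vector_space ?Q"
      using complex_vector_space_clutching_quotient[OF underlying_bundle \<psi> S] .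
    let ?s = "restrict (inv_into ?C (restrict ?p ?C)) (carrier ?Q)"
    have s_eq: "?s P = s P" if "P \<in> carrier ?Q" for P
      using that by (simp add: s_def inv_into_restrict)
    have "?s \<in> linear_maps ?Q (fiber F x0)"
      using linear_iso_inverse[OF fiber_vector_space[OF underlying_bundle x0] p0] by (simp add: linear_iso_def)
    moreover have "restrict ?p ?D \<in> linear_maps (fiber F (\<phi> g x0)) ?Q"
      using pg unfolding linear_iso_def by blast
    ultimately
    have "compose (carrier ?Q) (restrict ?p ?D) (compose (carrier ?Q) (restrict (\<rho> g) ?C) ?s)
        \<in> linear_maps ?Q ?Q"
      using linear_maps_compose[OF Q] action_linear[OF g x0] by meson
    also have "compose (carrier ?Q) (restrict ?p ?D) (compose (carrier ?Q) (restrict (\<rho> g) ?C) ?s) = \<tau> g"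
    proof
      fix P
      show "compose (carrier ?Q) (restrict ?p ?D) (compose (carrier ?Q) (restrict (\<rho> g) ?C) ?s) P = \<tau> g P"
        by (cases "P \<in> carrier ?Q")
          (use s_eq s action_fiber[OF g x0] in \<open>simp_all add: compose_def \<tau>_def\<close>)
    qed
    finally show ?thesis .
  qed
  have cont: "continuous_map (prod_topology T (canonical_topology ?Q)) (canonical_topology ?Q)
      (\<lambda>(g, P). \<tau> g P)"
  proof -
    have c\<rho>: "continuous_map (prod_topology T (total_space F)) (total_space F) (\<lambda>(g, u). \<rho> g u)"
      using F\<rho> by (simp add: equivariant_vector_bundle_def continuous_action_def)
    have cs: "continuous_map (canonical_topology ?Q) (total_space F) s"
      unfolding s_def using continuous_map_clutching_section[OF underlying_bundle \<psi> x0] .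
    \<comment> \<open>Joint continuity in \<open>g\<close> and \<open>P\<close> comes from lifting
      only the second argument and then applying the jointly continuous action on the total
      space.\<close>
    have "continuous_map (prod_topology T (canonical_topology ?Q)) (prod_topology T (total_space F))
        (\<lambda>(g, P). (g, s P))"
      using cs by (simp add: continuous_map_prod_top)
    from continuous_map_compose[OF continuous_map_compose[OF this c\<rho>]
        continuous_map_clutching_proj[OF underlying_bundle \<psi>]]
    show ?thesis
      by (rule continuous_map_eq) (auto simp: \<tau>_def topspace_canonical_topology)
  qed
  have "complex_representation G T ?Q \<tau>"
    unfolding complex_representation_def continuous_action_def topspace_canonical_topology
    using complex_vector_space_clutching_quotient[OF underlying_bundle \<psi> S]
      fin_dim_clutching_quotient[OF underlying_bundle \<psi> x0] action cont lin by blast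
  then show thesis using that[of \<tau>] \<tau>p by (simp add: quotient_representation_def)
qed

end

theorem lemma2p1:
  fixes G :: "('g, 'm) monoid_scheme" and T :: "'g topology" and n :: nat and A :: "'g chart set"
    and S :: "'x set" and \<phi> :: "'g \<Rightarrow> 'x \<Rightarrow> 'x"
    and F :: "('x, 'f) complex_bundle" and \<rho> :: "'g \<Rightarrow> 'f \<Rightarrow> 'f"
    and \<psi> :: "'x \<times> 'x \<Rightarrow> 'f \<Rightarrow> 'f"
  assumes "compact_lie_group G T n A"
    and "finite S" and "S \<noteq> {}"
    and "continuous_action G T (discrete_topology S) \<phi>"
    and "equivariant_vector_bundle G T (discrete_topology S) \<phi> F \<rho>"
    and "pointwise_clutching_map S F \<psi>"
  shows "(equivariant_clutching_map G S \<phi> F \<rho> \<psi> \<longleftrightarrow>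
           (\<exists>\<tau>. quotient_representation G T S F \<rho> \<psi> \<tau>)) \<and>
         (\<forall>\<tau> \<tau>'. quotient_representation G T S F \<rho> \<psi> \<tau> \<and> quotient_representation G T S F \<rho> \<psi> \<tau>' \<longrightarrow>
            (\<forall>g\<in>carrier G. \<tau> g = \<tau>' g))"
proof -
  have "group G"
    using assms(1) by (simp add: compact_lie_group_def lie_group_def)
  note hyps = this assms(3-6)
  show ?thesis
    using quotient_representation_exists[OF hyps] equivariant_if_quotient_representation[OF hyps]
      quotient_representation_unique[OF hyps] by metis
qed

end
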